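(* Let $p(n)=1$ if $n=2^j$ for some integer $j\geq 0$ and $p(n)=0$ otherwise $(n\geq 0)$. For $m\geq 0$ and $n\geq 1$ let $d(m,n)=\det\big(p(i+j+m)\big)_{i,j=0}^{n-1}$, and set $d(m,0)=1$. Then: (1) the sequence $\{d(0,n)\}_{n\geq 0}$ is $2$-regular; (2) for every integer $k\geq 1$, the sequence $\{d(2k,n)\}_{n\geq 0}$ is $2$-automatic; (3) for every integer $k\geq 0$, the sequence $\{d(2k+1,n)\}_{n\geq 0}$ is periodic.
   Context: The $2$-kernel of a sequence $\mathbf{u}=\{u(n)\}_{n\geq 0}$ is the set of subsequences $\{\{u(2^i n+j)\}_{n\geq 0}: i\geq 0,\ 0\leq j<2^i\}$. A sequence taking values in a finite set is $2$-automatic if its $2$-kernel is a finite set. An integer sequence is $2$-regular (over $\mathbb{Z}$) if there exist finitely many integer sequences such that every element of its $2$-kernel is a $\mathbb{Z}$-linear combination of them. *)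

theory Defs
  imports "Jordan_Normal_Form.Determinant"
begin

definition pow2_ind :: "nat \<Rightarrow> int" where
  "pow2_ind n = (if \<exists>j::nat. n = 2 ^ j then 1 else 0)"

(* For n = 0 the determinant of the empty matrix gives hankel_d m 0 = 1;
   see hankel_d_0. *)
definition hankel_d :: "nat \<Rightarrow> nat \<Rightarrow> int" where
  "hankel_d m n = det (mat n n (\<lambda>(i, j). pow2_ind (i + j + m)))"

lemma hankel_d_0: "hankel_d m 0 = 1"
  by (simp add: hankel_d_def)

definition kernel2 :: "(nat \<Rightarrow> 'a) \<Rightarrow> (nat \<Rightarrow> 'a) set" where
  "kernel2 u = {(\<lambda>n. u (2 ^ i * n + j)) | i j. j < 2 ^ i}"

definition automatic2 :: "(nat \<Rightarrow> 'a) \<Rightarrow> bool" where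
  "automatic2 u \<longleftrightarrow> finite (range u) \<and> finite (kernel2 u)"

definition regular2 :: "(nat \<Rightarrow> int) \<Rightarrow> bool" where
  "regular2 u \<longleftrightarrow>
     (\<exists>S :: (nat \<Rightarrow> int) set. finite S \<and>
        (\<forall>v \<in> kernel2 u. \<exists>c :: (nat \<Rightarrow> int) \<Rightarrow> int. \<forall>n. v n = (\<Sum>s\<in>S. c s * s n)))"

(* Pure periodicity: no pre-period is allowed. *)
definition periodic_seq :: "(nat \<Rightarrow> 'a) \<Rightarrow> bool" where
  "periodic_seq u \<longleftrightarrow> (\<exists>T>0. \<forall>n. u (n + T) = u n)"

end

theory Submission
  imports Defs
begin

text \<open>In a Leibniz term all rows and columns of large index are forced onto the antidiagonal
  \<open>i + j + m = 2 ^ k\<close>. Cancelling them gives, for \<open>m \<ge> 1\<close>, a reflection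
  \<open>d(m, n) = \<plusminus> d(m, 2 ^ k + 1 - m - n)\<close>, and two successive reflections express
  \<open>d(m, 2 ^ k + r)\<close> by \<open>d(m, r)\<close>. For odd \<open>m\<close> the signs cancel, which is periodicity. For even
  \<open>m\<close> a sign appears exactly when the leading \<open>1\<close> is followed by the digit \<open>0\<close>, so \<open>d(m, n)\<close>
  depends on the parity of the number of blocks \<open>10\<close> in the binary expansion of \<open>n\<close>, up to the
  lowest digits. For \<open>m = 0\<close> the reflection has a correction term \<open>d(2, \<cdot>)\<close>; each reflection
  complements the binary digits of \<open>n - 1\<close> and so removes one block of equal digits, and
  \<open>d(0, n + 1)\<close> is \<open>- d(2, n)\<close> times the number of these blocks.\<close>

subsection \<open>Determinants\<close>

text \<open>The Leibniz sums agree term by term: if all factors of \<open>f\<close> are nonzero, so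
  are those of \<open>g\<close>, and they coincide; a vanishing factor of \<open>f\<close> forces
  the same factor of \<open>g\<close> to vanish.\<close>

lemma det_eq_of_support:
  fixes f g :: "nat \<Rightarrow> nat \<Rightarrow> 'a::comm_ring_1"
  assumes sub: "\<And>i j. i < n \<Longrightarrow> j < n \<Longrightarrow> g i j \<noteq> 0 \<Longrightarrow> g i j = f i j"
    and supp: "\<And>\<sigma>. \<sigma> permutes {0..<n} \<Longrightarrow> (\<And>i. i < n \<Longrightarrow> f i (\<sigma> i) \<noteq> 0) \<Longrightarrow>
      (\<And>i. i < n \<Longrightarrow> g i (\<sigma> i) \<noteq> 0)"
  shows "det (mat n n (\<lambda>(i, j). f i j)) = det (mat n n (\<lambda>(i, j). g i j))"
proof -
  have "(\<Prod>i = 0..<n. f i (\<sigma> i)) = (\<Prod>i = 0..<n. g i (\<sigma> i))" if \<sigma>: "\<sigma> permutes {0..<n}" for \<sigma>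
  proof (cases "\<forall>i<n. f i (\<sigma> i) \<noteq> 0")
    case True
    then have "g i (\<sigma> i) = f i (\<sigma> i)" if "i < n" for i
      using sub[OF that] supp[OF \<sigma> _ that] permutes_nat_less[OF \<sigma> that] by auto
    then show ?thesis by (auto intro!: prod.cong)
  next
    case False
    then obtain i where i: "i < n" "f i (\<sigma> i) = 0" by auto
    then have "g i (\<sigma> i) = 0"
      using sub[OF i(1) permutes_nat_less[OF \<sigma> i(1)]] by metis
    with i have "(\<Prod>i = 0..<n. f i (\<sigma> i)) = 0" "(\<Prod>i = 0..<n. g i (\<sigma> i)) = 0"
      by (auto intro!: prod_zero)
    then show ?thesis by simp
  qed
  moreover have "(\<Prod>i = 0..<n. mat n n (\<lambda>(i, j). h i j) $$ (i, \<sigma> i)) = (\<Prod>i = 0..<n. h i (\<sigma> i))"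
    if "\<sigma> permutes {0..<n}" for \<sigma> and h :: "nat \<Rightarrow> nat \<Rightarrow> 'a"
    using permutes_nat_less[OF that] by (intro prod.cong) auto
  ultimately show ?thesis
    by (subst (1 2) det_def'[of _ n]) (auto intro!: sum.cong)
qed

lemma det_mat_block_lower:
  fixes f :: "nat \<Rightarrow> nat \<Rightarrow> 'a::idom"
  assumes "\<And>i j. i < k \<Longrightarrow> k \<le> j \<Longrightarrow> j < k + l \<Longrightarrow> f i j = 0"
  shows "det (mat (k + l) (k + l) (\<lambda>(i, j). f i j)) =
    det (mat k k (\<lambda>(i, j). f i j)) * det (mat l l (\<lambda>(i, j). f (i + k) (j + k)))"
proof -
  have "mat (k + l) (k + l) (\<lambda>(i, j). f i j) =
     four_block_mat (mat k k (\<lambda>(i, j). f i j)) (0\<^sub>m k l)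
       (mat l k (\<lambda>(i, j). f (i + k) j)) (mat l l (\<lambda>(i, j). f (i + k) (j + k)))"
    by (rule eq_matI) (auto simp: assms)
  then show ?thesis
    by (simp add: det_four_block_mat_upper_right_zero[OF _ refl])
qed

lemma det_antidiag:
  "det (mat l l (\<lambda>(i, j). if i + j + 1 = l then 1 else 0 :: 'a::comm_ring_1)) = (- 1) ^ (l div 2)"
proof (induction l)
  case 0
  show ?case by simp
next
  case (Suc l)
  let ?J = "\<lambda>l. mat l l (\<lambda>(i, j). if i + j + 1 = l then 1 else 0 :: 'a)"
  have del: "mat_delete (?J (Suc l)) 0 l = ?J l"
    by (rule eq_matI) (auto simp: mat_delete_def)
  have "det (?J (Suc l)) = (\<Sum>j<Suc l. ?J (Suc l) $$ (0, j) * cofactor (?J (Suc l)) 0 j)"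
    by (rule laplace_expansion_row) auto
  also have "\<dots> = (\<Sum>j<Suc l. if j = l then cofactor (?J (Suc l)) 0 l else 0)"
    by (rule sum.cong) auto
  also have "\<dots> = (- 1) ^ l * (- 1) ^ (l div 2)"
    using Suc by (simp add: cofactor_def del[simplified])
  also have "\<dots> = (- 1) ^ (Suc l div 2)"
    by (cases "even l") (auto simp: elim!: evenE oddE)
  finally show ?case .
qed

text \<open>First-row cofactors ignore the corner entry, so the determinant is affine in it, with
  the corner minor as slope.\<close>

lemma det_mat_upd_corner:
  fixes f :: "nat \<Rightarrow> nat \<Rightarrow> 'a::comm_ring_1"
  shows "det (mat (Suc n) (Suc n) (\<lambda>(i, j). if i = 0 \<and> j = 0 then f 0 0 + c else f i j)) =
    det (mat (Suc n) (Suc n) (\<lambda>(i, j). f i j)) + c * det (mat n n (\<lambda>(i, j). f (Suc i) (Suc j)))"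
    (is "det ?B = det ?A + c * det ?C")
proof -
  have del: "mat_delete ?B 0 j = mat_delete ?A 0 j" for j
    by (rule eq_matI) (auto simp: mat_delete_def)
  then have cof: "cofactor ?B 0 j = cofactor ?A 0 j" for j
    by (simp add: cofactor_def)
  have del0: "mat_delete ?A 0 0 = ?C"
    by (rule eq_matI) (auto simp: mat_delete_def)
  have "det ?B = (\<Sum>j<Suc n. ?B $$ (0, j) * cofactor ?B 0 j)"
    by (rule laplace_expansion_row) auto
  also have "\<dots> = (\<Sum>j<Suc n. ?A $$ (0, j) * cofactor ?A 0 j + (if j = 0 then c * cofactor ?A 0 0 else 0))"
    by (rule sum.cong) (auto simp: cof algebra_simps)
  also have "\<dots> = (\<Sum>j<Suc n. ?A $$ (0, j) * cofactor ?A 0 j) + c * cofactor ?A 0 0"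
    by (subst sum.distrib) (simp del: sum.lessThan_Suc)
  also have "(\<Sum>j<Suc n. ?A $$ (0, j) * cofactor ?A 0 j) = det ?A"
    by (rule laplace_expansion_row[symmetric]) auto
  also have "cofactor ?A 0 0 = det ?C"
    by (simp add: cofactor_def del0)
  finally show ?thesis .
qed

subsection \<open>Reflections of the Hankel determinants\<close>

lemma pow2_ind_nz: "pow2_ind n \<noteq> 0 \<longleftrightarrow> (\<exists>j. n = 2 ^ j)"
  by (auto simp: pow2_ind_def)

lemma pow2_ind_power [simp]: "pow2_ind (2 ^ j) = 1"
  by (auto simp: pow2_ind_def)

lemma pow2_ind_between:
  assumes "2 ^ k < n" "n < 2 ^ Suc k"
  shows "pow2_ind n = 0"
proof (rule ccontr)
  assume "pow2_ind n \<noteq> 0"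
  then obtain j where "n = 2 ^ j" by (auto simp: pow2_ind_nz)
  with assms have "(2::nat) ^ k < 2 ^ j" "(2::nat) ^ j < 2 ^ Suc k" by auto
  then have "k < j" "j < Suc k"
    by (simp_all only: power_strict_increasing_iff one_less_numeral_iff semiring_norm)
  then show False by simp
qed

lemma pow2_ind_near:
  assumes "pow2_ind n \<noteq> 0" "2 ^ k < n" "n < 2 ^ Suc (Suc k)"
  shows "n = 2 ^ Suc k"
  using assms pow2_ind_between[of k n] pow2_ind_between[of "Suc k" n] by linarith

text \<open>All arguments in the last row lie strictly between \<open>2 ^ k\<close> and
  \<open>2 ^ Suc k\<close>.\<close>

lemma hankel_d_zero:
  assumes "1 \<le> n" "2 ^ k < n - 1 + m" "2 * n + m < 2 ^ Suc k + 2"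
  shows "hankel_d m n = 0"
proof -
  have z: "pow2_ind (n + j + m - Suc 0) = 0" if "j < n" for j
    using assms that by (intro pow2_ind_between[of k]) auto
  have "hankel_d m n = (\<Sum>j<n. mat n n (\<lambda>(i, j). pow2_ind (i + j + m)) $$ (n - 1, j) *
      cofactor (mat n n (\<lambda>(i, j). pow2_ind (i + j + m))) (n - 1) j)"
    unfolding hankel_d_def using assms(1) by (intro laplace_expansion_row) auto
  also have "\<dots> = 0"
    using assms(1) by (intro sum.neutral) (auto simp: z)
  finally show ?thesis .
qed

text \<open>A row or column with index \<open>> 2 ^ k - m\<close> has its only nonzero entry on the antidiagonal
  \<open>i + j + m = 2 ^ (k + 1)\<close>. Any other row from \<open>n'\<close> on meets this antidiagonal in such a
  column, so a nonzero Leibniz term follows the antidiagonal there too. For \<open>m = 0\<close> the index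
  \<open>2 ^ k\<close> is on the boundary and two extra entries survive.\<close>

lemma hankel_support:
  assumes sum: "n' + n + m = 2 ^ Suc k + 1" and le: "n' \<le> n"
    and \<sigma>: "\<sigma> permutes {0..<n}" and nz: "\<And>i. i < n \<Longrightarrow> pow2_ind (i + \<sigma> i + m) \<noteq> 0"
    and i: "i < n" and out: "n' \<le> i \<or> n' \<le> \<sigma> i" and n': "m = 0 \<Longrightarrow> 1 \<le> n'"
  shows "i + \<sigma> i + m = 2 ^ Suc k \<or> m = 0 \<and> (i = 0 \<and> \<sigma> i = 2 ^ k \<or> i = 2 ^ k \<and> \<sigma> i = 0)"
proof -
  have \<sigma>n: "\<sigma> j < n" if "j < n" for j using permutes_nat_less[OF \<sigma> that] .
  \<comment> \<open>The largest argument is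
    \<open>2 * (n - 1) + m = 2 ^ (k + 2) - m - 2 * n'\<close>; this is where \<open>m = 0\<close>
    calls for \<open>1 \<le> n'\<close>.\<close>
  have bound: "a + b + m < 2 ^ Suc (Suc k)" if "a < n" "b < n" for a b
    using that sum n' by (cases m) auto
  have high: "a + \<sigma> a + m = 2 ^ Suc k" if "a < n" "2 ^ k < a + \<sigma> a + m" for a
    using pow2_ind_near[OF nz[OF that(1)] that(2) bound[OF that(1) \<sigma>n[OF that(1)]]] .
  have inj: "a = b" if "\<sigma> a = \<sigma> b" for a b
    using permutes_inj[OF \<sigma>] that by (meson injD)
  show ?thesis
  proof (cases "2 ^ k < i + \<sigma> i + m")
    case True
    then show ?thesis using high[OF i] by simp
  next
    case False
    consider "n' \<le> i" | "n' \<le> \<sigma> i" using out by auto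
    then show ?thesis
    proof cases
      case 1
      \<comment> \<open>Row \<open>i\<close> meets the antidiagonal in column \<open>j\<close>, and
        \<open>n' \<le> i\<close> gives \<open>j < n\<close>. Off the boundary case, the row
        \<open>a\<close> that uses column \<open>j\<close> turns out to be \<open>i\<close>.\<close>
      define j where "j = 2 ^ Suc k - m - i"
      have j: "j + m + i = 2 ^ Suc k" "j < n" using 1 False sum i by (auto simp: j_def)
      obtain a where a: "a < n" "\<sigma> a = j"
        using permutes_image[OF \<sigma>] j(2) by (metis atLeastLessThan_iff image_iff le0)
      show ?thesis
      proof (cases "2 ^ k < a + j + m")
        case True
        then have "a = i" using high[OF a(1)] a(2) j(1) by simp
        with a j show ?thesis by simp
      next
        case F2: False
        \<comment> \<open>Adding the two failed bounds and subtracting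
          \<open>j + m + i = 2 ^ Suc k\<close> leaves
          \<open>a + \<sigma> i + m \<le> 0\<close>.\<close>
        with j False have "m = 0" "a = 0" "\<sigma> i = 0" "i = 2 ^ k"
          by auto
        then show ?thesis by simp
      qed
    next
      case 2
      define a where "a = 2 ^ Suc k - m - \<sigma> i"
      have a: "a + m + \<sigma> i = 2 ^ Suc k" "a < n" using 2 False sum \<sigma>n[OF i] by (auto simp: a_def)
      show ?thesis
      proof (cases "2 ^ k < a + \<sigma> a + m")
        case True
        then have "\<sigma> a = \<sigma> i" using high[OF a(2)] a(1) by simp
        with inj a show ?thesis by (metis add.commute add.left_commute)
      next
        case F2: False
        with a False have "m = 0" "i = 0" "\<sigma> i = 2 ^ k"
          by auto
        then show ?thesis by simp
      qed
    qed
  qed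
qed

lemma hankel_reflect:
  assumes m: "1 \<le> m" and le: "n' \<le> n" and sum: "n' + n + m = 2 ^ Suc k + 1"
  shows "hankel_d m n = (- 1) ^ ((n - n') div 2) * hankel_d m n'"
proof -
  \<comment> \<open>\<open>g\<close> keeps the leading block of size \<open>n'\<close> and, outside
    it, only the antidiagonal.\<close>
  define g :: "nat \<Rightarrow> nat \<Rightarrow> int" where
    "g i j = (if i < n' \<and> j < n' then pow2_ind (i + j + m)
       else if i + j + m = 2 ^ Suc k then 1 else 0)" for i j
  have "hankel_d m n = det (mat n n (\<lambda>(i, j). g i j))"
    unfolding hankel_d_def
  proof (rule det_eq_of_support)
    fix i j show "g i j \<noteq> 0 \<Longrightarrow> g i j = pow2_ind (i + j + m)"
      by (auto simp: g_def simp del: power_Suc split: if_splits)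
  next
    fix \<sigma> i
    assume \<sigma>: "\<sigma> permutes {0..<n}" "\<And>i. i < n \<Longrightarrow> pow2_ind (i + \<sigma> i + m) \<noteq> 0" and i: "i < n"
    show "g i (\<sigma> i) \<noteq> 0"
      using hankel_support[OF sum le \<sigma> i] \<sigma>(2)[OF i] m
      by (cases "n' \<le> i \<or> n' \<le> \<sigma> i") (auto simp: g_def)
  qed
  also obtain l where l: "n = n' + l" using le le_Suc_ex by auto
  have "det (mat n n (\<lambda>(i, j). g i j)) =
      det (mat n' n' (\<lambda>(i, j). g i j)) * det (mat l l (\<lambda>(i, j). g (i + n') (j + n')))"
    unfolding l
  proof (rule det_mat_block_lower)
    \<comment> \<open>Here \<open>i + j + m \<le> n' + n + m - 2 < 2 ^ Suc k\<close>, so the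
      antidiagonal misses this block.\<close>
    fix i j assume "i < n'" "n' \<le> j" "j < n' + l"
    then show "g i j = 0" using sum l by (auto simp: g_def)
  qed
  also have "mat n' n' (\<lambda>(i, j). g i j) = mat n' n' (\<lambda>(i, j). pow2_ind (i + j + m))"
    by (rule eq_matI) (auto simp: g_def)
  also have "mat l l (\<lambda>(i, j). g (i + n') (j + n')) =
      mat l l (\<lambda>(i, j). if i + j + 1 = l then 1 else 0)"
    using sum l by (intro eq_matI) (auto simp: g_def)
  also have "det \<dots> = (- 1) ^ (l div 2)" by (rule det_antidiag)
  finally show ?thesis by (simp add: l hankel_d_def)
qed

text \<open>For \<open>m = 0\<close> the entries \<open>(0, 2 ^ k)\<close> and
  \<open>(2 ^ k, 0)\<close> also survive. A row operation trades the first for a change of the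
  corner entry, whose minor is \<open>hankel_d 2 n'\<close>.\<close>

lemma hankel_reflect_0:
  assumes le: "n' \<le> n" and sum: "n' + n + 1 = 2 ^ Suc k"
  shows "hankel_d 0 (Suc n) = (- 1) ^ ((n - n') div 2) * (hankel_d 0 (Suc n') - hankel_d 2 n')"
proof -
  define c :: nat where "c = 2 ^ k"
  have c: "2 ^ Suc k = c + c" "0 < c" by (auto simp: c_def)
  have nc: "n' + n + 1 = c + c" "n' < c" "c \<le> n" using sum le c by auto
  define g :: "nat \<Rightarrow> nat \<Rightarrow> int" where
    "g i j = (if i \<le> n' \<and> j \<le> n' then pow2_ind (i + j)
       else if i + j = c + c \<or> i = 0 \<and> j = c \<or> i = c \<and> j = 0 then 1 else 0)" for i j
  define h where "h i j = (if i = 0 then g i j - g c j else g i j)" for i j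
  have "hankel_d 0 (Suc n) = det (mat (Suc n) (Suc n) (\<lambda>(i, j). g i j))"
    unfolding hankel_d_def
  proof (rule det_eq_of_support)
    have p: "pow2_ind c = 1" "pow2_ind (c + c) = 1"
      unfolding c(1)[symmetric] by (auto simp: c_def simp del: power_Suc)
    fix i j show "g i j \<noteq> 0 \<Longrightarrow> g i j = pow2_ind (i + j + 0)"
      by (auto simp: g_def p split: if_splits)
  next
    fix \<sigma> i
    assume \<sigma>: "\<sigma> permutes {0..<Suc n}" "\<And>i. i < Suc n \<Longrightarrow> pow2_ind (i + \<sigma> i + 0) \<noteq> 0"
      and i: "i < Suc n"
    have s: "Suc n' + Suc n + 0 = 2 ^ Suc k + 1" using sum by simp
    show "g i (\<sigma> i) \<noteq> 0"
      using hankel_support[OF s _ \<sigma> i] \<sigma>(2)[OF i] le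
      by (cases "Suc n' \<le> i \<or> Suc n' \<le> \<sigma> i") (auto simp: g_def c_def)
  qed
  \<comment> \<open>Row \<open>c\<close> has ones exactly in columns \<open>0\<close> and
    \<open>c\<close>. Subtracting it from row \<open>0\<close> clears \<open>(0, c)\<close> and
    lowers the corner by \<open>1\<close>; the entry \<open>(c, 0)\<close> lies in the lower left
    block and does no harm.\<close>
  also have "\<dots> = det (addrow (- 1) 0 c (mat (Suc n) (Suc n) (\<lambda>(i, j). g i j)))"
    using nc by (intro det_addrow[symmetric, of _ "Suc n"]) auto
  also have "addrow (- 1) 0 c (mat (Suc n) (Suc n) (\<lambda>(i, j). g i j)) =
      mat (Suc n) (Suc n) (\<lambda>(i, j). h i j)"
    using nc by (intro eq_matI) (auto simp: h_def)
  also obtain l where l: "n = n' + l" using le le_Suc_ex by auto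
  then have l': "Suc n = Suc n' + l" by simp
  have "det (mat (Suc n) (Suc n) (\<lambda>(i, j). h i j)) =
      det (mat (Suc n') (Suc n') (\<lambda>(i, j). h i j)) *
      det (mat l l (\<lambda>(i, j). h (i + Suc n') (j + Suc n')))"
    unfolding l'
  proof (rule det_mat_block_lower)
    fix i j assume "i < Suc n'" "Suc n' \<le> j" "j < Suc n' + l"
    then show "h i j = 0" using nc l' by (auto simp: h_def g_def)
  qed
  also have "mat (Suc n') (Suc n') (\<lambda>(i, j). h i j) = mat (Suc n') (Suc n')
      (\<lambda>(i, j). if i = 0 \<and> j = 0 then pow2_ind (0 + 0 + 0) + (- 1) else pow2_ind (i + j + 0))"
    using nc by (intro eq_matI) (auto simp: h_def g_def)
  also have "det \<dots> = hankel_d 0 (Suc n') - hankel_d 2 n'"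
    by (subst det_mat_upd_corner) (simp add: hankel_d_def)
  also have "mat l l (\<lambda>(i, j). h (i + Suc n') (j + Suc n')) =
      mat l l (\<lambda>(i, j). if i + j + 1 = l then 1 else 0)"
    using nc l by (intro eq_matI) (auto simp: h_def g_def)
  also have "det \<dots> = (- 1) ^ (l div 2)" by (rule det_antidiag)
  finally show ?thesis by (simp add: l)
qed

text \<open>The partner size \<open>2 ^ k + 1 - m - n\<close> would be negative. Either the last row
  is zero already, or one reflection at \<open>2 ^ Suc k\<close> leads to a matrix whose last row
  is.\<close>

lemma hankel_d_zero_gap:
  assumes m: "1 \<le> m" "m \<le> 2 ^ k + 1" and n: "n < 2 ^ k" "2 ^ k + 1 < n + m"
  shows "hankel_d m n = 0"
proof (cases "2 * n + m < 2 ^ Suc k + 2")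
  case True
  with m n show ?thesis by (intro hankel_d_zero[of n k]) auto
next
  case False
  define n' where "n' = 2 ^ Suc k + 1 - m - n"
  have n': "n' + n + m = 2 ^ Suc k + 1" using m n by (simp add: n'_def)
  have "hankel_d m n = (- 1) ^ ((n - n') div 2) * hankel_d m n'"
    using False n' m by (intro hankel_reflect[where k = k]) auto
  also have "hankel_d m n' = 0"
    using False n' m n by (intro hankel_d_zero[of n' k]) auto
  finally show ?thesis by simp
qed

text \<open>Both \<open>2 ^ k + r\<close> and \<open>r\<close> reflect to the same size
  \<open>s\<close>, at \<open>2 ^ Suc k\<close> and \<open>2 ^ k\<close> respectively, so only the
  signs have to be compared. If \<open>s\<close> would be negative, both determinants
  vanish.\<close>

lemma hankel_d_add_pow2:
  assumes k: "2 \<le> k" and m: "1 \<le> m" "m \<le> 2 ^ k + 1" and r: "r < 2 ^ k"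
  shows "hankel_d m (2 ^ k + r) = (if even m \<and> 2 * r + m < 2 ^ k + 1 then - 1 else 1) * hankel_d m r"
proof (cases "r + m \<le> 2 ^ k + 1")
  case False
  then have "hankel_d m r = 0" using m r by (intro hankel_d_zero_gap[of m k]) auto
  moreover have "hankel_d m (2 ^ k + r) = 0"
    using False m r by (intro hankel_d_zero_gap[of m "Suc k"]) auto
  ultimately show ?thesis by simp
next
  case True
  define s where "s = 2 ^ k + 1 - m - r"
  have s: "s + r + m = 2 ^ k + 1" using True by (simp add: s_def)
  obtain k' where k': "k = Suc (Suc k')" using k by (metis add_2_eq_Suc le_Suc_ex)
  have "s \<le> 2 ^ k" using s m by simp
  then have 1: "hankel_d m (2 ^ k + r) = (- 1) ^ ((2 ^ k + r - s) div 2) * hankel_d m s"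
    using s m by (intro hankel_reflect[where k = k]) auto
  \<comment> \<open>Since \<open>4\<close> divides \<open>2 ^ k\<close>, enlarging an antidiagonal
    block by \<open>2 ^ k\<close> does not change its sign.\<close>
  have dvd: "(2::nat) ^ k = 4 * 2 ^ k'" by (simp add: k')
  show ?thesis
  proof (cases "s \<le> r")
    case le: True
    then obtain t where t: "r = s + t" using le_Suc_ex by auto
    have "hankel_d m r = (- 1) ^ ((r - s) div 2) * hankel_d m s"
      using s m le by (intro hankel_reflect[where k = "Suc k'"]) (auto simp: k')
    moreover have "(2 ^ k + r - s) div 2 = 2 * 2 ^ k' + (r - s) div 2"
      unfolding dvd t by simp
    moreover have "\<not> 2 * r + m < 2 ^ k + 1" using s le by simp
    ultimately show ?thesis using 1 by (simp add: power_add power_mult)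
  next
    case False
    then obtain t where t: "s = r + t" using le_Suc_ex nat_le_linear by metis
    have "hankel_d m s = (- 1) ^ ((s - r) div 2) * hankel_d m r"
      using s m False by (intro hankel_reflect[where k = "Suc k'"]) (auto simp: k')
    then have 2: "hankel_d m (2 ^ k + r) =
        (- 1) ^ ((2 ^ k + r - s) div 2 + (s - r) div 2) * hankel_d m r"
      using 1 by (simp add: power_add)
    have lt: "2 * r + m < 2 ^ k + 1" using s False by simp
    have st: "2 * r + t + m = 4 * 2 ^ k' + 1" using s t dvd by simp
    \<comment> \<open>The block sizes \<open>2 ^ k - t\<close> and \<open>t\<close> sum to a
      multiple of \<open>4\<close>; halving them loses \<open>1\<close> in total exactly when
      \<open>t\<close> is odd, that is, when \<open>m\<close> is even.\<close>
    have e: "(2 ^ k + r - s) div 2 + (s - r) div 2 = (4 * 2 ^ k' - t) div 2 + t div 2"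
      unfolding dvd t by simp
    show ?thesis
    proof (cases "even m")
      case True
      with st have "odd t" by presburger
      then obtain w where w: "t = 2 * w + 1" by (elim oddE)
      define v where "v = 2 * 2 ^ k' - w - 1"
      have v: "v + w + 1 = 2 * 2 ^ k'" using st w m by (simp add: v_def)
      then have "4 * 2 ^ k' - t = 2 * v + 1" by (simp add: w)
      then have "(4 * 2 ^ k' - t) div 2 + t div 2 = v + w" by (simp add: w)
      moreover have "odd (v + w)" using v by (metis dvd_triv_left even_add odd_one)
      ultimately show ?thesis using 2 e lt True by simp
    next
      case F: False
      with st have "even t" by presburger
      then obtain w where w: "t = 2 * w" by (elim evenE)
      define v where "v = 2 * 2 ^ k' - w"
      have v: "v + w = 2 * 2 ^ k'" using st w m by (simp add: v_def)
      then have "4 * 2 ^ k' - t = 2 * v" by (simp add: w)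
      then have "(4 * 2 ^ k' - t) div 2 + t div 2 = 2 * 2 ^ k'" using v by (simp add: w)
      then show ?thesis using 2 e F by (simp add: power_add power_mult)
    qed
  qed
qed

section \<open>Odd shifts: reduction modulo a power of two\<close>

lemma power2_decomp:
  fixes n :: nat
  assumes "0 < n"
  obtains k r where "n = 2 ^ k + r" "r < 2 ^ k"
proof -
  obtain k where "2 ^ k \<le> n" "n < 2 ^ (k + 1)"
    using ex_power_ivl1[of 2 n] assms by auto
  then show thesis by (intro that[of k "n - 2 ^ k"]) auto
qed

lemma exponent_bound: "m \<le> 2 ^ (m + 2) + (1::nat)"
  using less_exp[of "m + 2"] by linarith

lemma periodic_hankel_odd:
  assumes "odd m"
  shows "periodic_seq (hankel_d m)"
proof -
  \<comment> \<open>Large enough for \<open>hankel_d_add_pow2\<close> to apply to every leading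
    power \<open>2 ^ k\<close> with \<open>K \<le> k\<close>; hence \<open>2 ^ K\<close> is a period
    from the start.\<close>
  define K where "K = m + 2"
  have m: "1 \<le> m" "m \<le> 2 ^ K + 1"
    using assms exponent_bound by (auto simp: K_def elim: oddE)
  have red: "hankel_d m n = hankel_d m (n mod 2 ^ K)" for n
  proof (induction n rule: less_induct)
    case (less n)
    show ?case
    proof (cases "n < 2 ^ K")
      case False
      then obtain k r where kr: "n = 2 ^ k + r" "r < 2 ^ k"
        by (metis power2_decomp not_gr_zero zero_less_numeral zero_less_power)
      have k: "K \<le> k"
      proof (rule ccontr)
        assume "\<not> K \<le> k"
        then have "(2::nat) ^ Suc k \<le> 2 ^ K" by (intro power_increasing) auto
        with kr False show False by simp
      qed
      then have "(2::nat) ^ K \<le> 2 ^ k" by (intro power_increasing) auto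
      then have "hankel_d m n = hankel_d m r"
        unfolding kr(1) using k m kr(2) assms
        by (subst hankel_d_add_pow2) (auto simp: K_def)
      also have "\<dots> = hankel_d m (r mod 2 ^ K)"
        using kr by (intro less.IH) auto
      also have "r mod 2 ^ K = n mod 2 ^ K"
      proof -
        have "2 ^ k mod (2::nat) ^ K = 0" using k by (simp add: le_imp_power_dvd)
        then show ?thesis unfolding kr(1) by (metis add_0 mod_add_left_eq)
      qed
      finally show ?thesis .
    qed simp
  qed
  then have "hankel_d m (n + 2 ^ K) = hankel_d m n" for n
    by (metis mod_add_self2)
  then show ?thesis unfolding periodic_seq_def by (intro exI[of _ "2 ^ K"]) auto
qed

subsection \<open>Even shifts\<close>

text \<open>Turns the sign condition into one on digits: a \<open>0\<close> follows the leading
  \<open>1\<close>. The two conditions differ only where \<open>hankel_d_zero_gap\<close> makes the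
  determinant vanish.\<close>

lemma hankel_d_add_pow2_even:
  assumes k: "1 \<le> k" and m: "even m" "1 \<le> m" "m \<le> 2 ^ k + 1" and r: "r < 2 ^ Suc k"
  shows "hankel_d m (2 ^ Suc k + r) = (if r < 2 ^ k then - 1 else 1) * hankel_d m r"
proof -
  have eq: "hankel_d m (2 ^ Suc k + r) =
      (if even m \<and> 2 * r + m < 2 ^ Suc k + 1 then - 1 else 1) * hankel_d m r"
    using assms by (intro hankel_d_add_pow2) auto
  show ?thesis
  proof (cases "r < 2 ^ k \<and> \<not> 2 * r + m < 2 ^ Suc k + 1")
    case True
    have "even (2 * r + m)" "odd (2 ^ Suc k + 1 :: nat)" using m(1) by simp_all
    then have "2 * r + m \<noteq> 2 ^ Suc k + 1" by metis
    with True have "2 * r + m \<ge> 2 * 2 ^ k + 2" "r < 2 ^ k" by auto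
    then have "2 ^ k + 1 < r + m" by linarith
    then have "hankel_d m r = 0"
      using True m by (intro hankel_d_zero_gap[of m k]) auto
    with eq show ?thesis by simp
  next
    case False
    then show ?thesis using eq m by auto
  qed
qed

text \<open>\<open>block_sign q = (-1)\<^sup>b\<close> with \<open>b\<close> the number of blocks \<open>10\<close> in the binary expansion of \<open>q\<close>.\<close>

fun block_sign :: "nat \<Rightarrow> int" where
  "block_sign n = (if n = 0 then 1 else
     block_sign (n div 2) * (if even n \<and> odd (n div 2) then - 1 else 1))"

declare block_sign.simps [simp del]

lemma block_sign_0 [simp]: "block_sign 0 = 1"
  by (simp add: block_sign.simps)

lemma block_sign_double: "block_sign (2 * n) = block_sign n * (if odd n then - 1 else 1)"
  by (cases "n = 0") (auto simp: block_sign.simps[of "2 * n"])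

lemma block_sign_Suc_double: "block_sign (Suc (2 * n)) = block_sign n"
  by (simp add: block_sign.simps[of "Suc (2 * n)"])

lemma block_sign_values: "block_sign n \<in> {- 1, 1}"
proof (induction n rule: block_sign.induct)
  case (1 n)
  then show ?case by (cases "n = 0") (auto simp: block_sign.simps[of n])
qed

text \<open>A \<open>0\<close> after the leading \<open>1\<close> creates one more block
  \<open>10\<close>. As \<open>block_sign\<close> recurses at the lowest digit while the
  determinants lose their leading digit, the induction strips low digits.\<close>

lemma block_sign_top:
  "q < 2 ^ Suc s \<Longrightarrow> block_sign (2 ^ Suc s + q) = (if q < 2 ^ s then - 1 else 1) * block_sign q"
proof (induction s arbitrary: q)
  case 0
  have "block_sign 1 = 1" "block_sign 2 = - 1" "block_sign 3 = 1"
    using block_sign_Suc_double[of 0] block_sign_double[of 1] block_sign_Suc_double[of 1]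
    by (simp_all add: numeral_2_eq_2 numeral_3_eq_3)
  moreover have "q = 0 \<or> q = 1" using 0 by auto
  ultimately show ?case by (auto simp: numeral_2_eq_2 numeral_3_eq_3)
next
  case (Suc s)
  define p where "p = q div 2"
  have p: "p < 2 ^ Suc s" using Suc.prems by (auto simp: p_def)
  have odd: "odd (2 ^ Suc s + p) \<longleftrightarrow> odd p" by simp
  consider "q = 2 * p" | "q = Suc (2 * p)" unfolding p_def by linarith
  then show ?case
  proof cases
    case 1
    then have e: "2 ^ Suc (Suc s) + q = 2 * (2 ^ Suc s + p)" "q < 2 ^ Suc s \<longleftrightarrow> p < 2 ^ s" by auto
    have "block_sign q = block_sign p * (if odd p then - 1 else 1)"
      by (simp only: 1 block_sign_double)
    then show ?thesis by (simp only: e block_sign_double Suc.IH[OF p] odd mult.assoc)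
  next
    case 2
    then have e: "2 ^ Suc (Suc s) + q = Suc (2 * (2 ^ Suc s + p))" "q < 2 ^ Suc s \<longleftrightarrow> p < 2 ^ s"
      by auto
    have "block_sign q = block_sign p"
      by (simp only: 2 block_sign_Suc_double)
    then show ?thesis by (simp only: e block_sign_Suc_double Suc.IH[OF p])
  qed
qed

text \<open>Induction removes the leading \<open>1\<close> of \<open>q\<close>. While further digits
  of \<open>q\<close> follow, the sign is that of \<open>block_sign_top\<close>; for
  \<open>q = 1\<close> the part \<open>r\<close> follows, which leaves the junction factor.\<close>

lemma hankel_d_even_digits:
  assumes K: "2 \<le> K" and m: "even m" "1 \<le> m" "m \<le> 2 ^ K + 1" and r: "r < 2 ^ K"
  shows "hankel_d m (2 ^ K * q + r) =
    block_sign q * (if odd q \<and> 2 * r + m < 2 ^ K + 1 then - 1 else 1) * hankel_d m r"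
proof (induction q rule: less_induct)
  case (less q)
  show ?case
  proof (cases "q = 0")
    case False
    then obtain s q' where q: "q = 2 ^ s + q'" "q' < 2 ^ s" using power2_decomp by blast
    show ?thesis
    proof (cases s)
      case 0
      then have "q = 1" using q by simp
      moreover have "block_sign 1 = 1" using block_sign_Suc_double[of 0] by simp
      ultimately show ?thesis using hankel_d_add_pow2[OF K m(2,3) r] m(1) by simp
    next
      case (Suc t)
      define R where "R = 2 ^ K * q' + r"
      have lt: "2 ^ K * q' + r < 2 ^ K * x \<longleftrightarrow> q' < x" for x
      proof
        assume "q' < x"
        then have "2 ^ K * Suc q' \<le> 2 ^ K * x" by (intro mult_le_mono) auto
        then show "2 ^ K * q' + r < 2 ^ K * x" using r by simp
      next
        assume "2 ^ K * q' + r < 2 ^ K * x"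
        then show "q' < x" by (metis add_lessD1 mult_less_cancel1)
      qed
      have eq: "2 ^ K * q + r = 2 ^ Suc (K + t) + R"
        by (simp add: q(1) Suc R_def algebra_simps power_add)
      have R: "R < 2 ^ Suc (K + t)"
        using lt[of "2 ^ s"] q(2) by (simp add: R_def Suc power_add)
      have "m \<le> 2 ^ (K + t) + 1"
        using m(3) power_increasing[of K "K + t" "2::nat"] by linarith
      with K have "hankel_d m (2 ^ K * q + r) =
          (if R < 2 ^ (K + t) then - 1 else 1) * hankel_d m R"
        unfolding eq by (intro hankel_d_add_pow2_even m(1,2) R) auto
      also have "R < 2 ^ (K + t) \<longleftrightarrow> q' < 2 ^ t"
        using lt[of "2 ^ t"] by (simp add: R_def power_add)
      also have "hankel_d m R =
          block_sign q' * (if odd q' \<and> 2 * r + m < 2 ^ K + 1 then - 1 else 1) * hankel_d m r"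
        unfolding R_def using q by (intro less.IH) auto
      also have "odd q' \<longleftrightarrow> odd q" by (simp add: q(1) Suc)
      finally show ?thesis
        using block_sign_top[of q' t] q(2) by (simp add: q(1) Suc del: power_Suc)
    qed
  qed simp
qed

text \<open>Closure under both decimations puts all kernel elements of level at least
  \<open>K\<close> into \<open>T\<close>; the levels below \<open>K\<close> contribute only finitely
  many.\<close>

lemma finite_kernel2I:
  assumes fin: "finite T"
    and closed: "\<And>v. v \<in> T \<Longrightarrow> (\<lambda>n. v (2 * n)) \<in> T" "\<And>v. v \<in> T \<Longrightarrow> (\<lambda>n. v (Suc (2 * n))) \<in> T"
    and base: "\<And>j. j < 2 ^ K \<Longrightarrow> (\<lambda>n. u (2 ^ K * n + j)) \<in> T"
  shows "finite (kernel2 u)"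
proof -
  have T: "(\<lambda>n. u (2 ^ (K + s) * n + j)) \<in> T" if "j < 2 ^ (K + s)" for s j
    using that
  proof (induction s arbitrary: j)
    case 0
    then show ?case using base by simp
  next
    case (Suc s)
    show ?case
    proof (cases "j < 2 ^ (K + s)")
      case True
      from closed(1)[OF Suc.IH[OF True]] show ?thesis by (simp add: mult_ac)
    next
      case False
      define i where "i = j - 2 ^ (K + s)"
      have i: "j = i + 2 ^ (K + s)" "i < 2 ^ (K + s)" using False Suc.prems by (auto simp: i_def)
      from closed(2)[OF Suc.IH[OF i(2)]] show ?thesis by (simp add: i(1) algebra_simps)
    qed
  qed
  have "kernel2 u \<subseteq> T \<union> (\<Union>i<K. (\<lambda>j n. u (2 ^ i * n + j)) ` {..<2 ^ i})"
  proof
    fix v assume "v \<in> kernel2 u"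
    then obtain i j where v: "v = (\<lambda>n. u (2 ^ i * n + j))" "j < 2 ^ i"
      by (auto simp: kernel2_def)
    show "v \<in> T \<union> (\<Union>i<K. (\<lambda>j n. u (2 ^ i * n + j)) ` {..<2 ^ i})"
    proof (cases "i < K")
      case False
      then obtain s where "i = K + s" using le_Suc_ex not_less by blast
      then show ?thesis using T v by auto
    qed (use v in auto)
  qed
  then show ?thesis by (rule finite_subset) (use fin in auto)
qed

lemma automatic_hankel_even:
  assumes "even m" "1 \<le> m"
  shows "automatic2 (hankel_d m)"
proof -
  define K where "K = m + 2"
  have K: "2 \<le> K" "m \<le> 2 ^ K + 1" using exponent_bound by (auto simp: K_def)
  note digits = hankel_d_even_digits[OF K(1) assms K(2)]
  \<comment> \<open>\<open>V\<close> holds the values on sizes below \<open>2 ^ K\<close> with both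
    signs, so that it is closed under negation.\<close>
  define V where "V = (\<lambda>(e, r). e * hankel_d m r) ` ({- 1, 1} \<times> {..<2 ^ K})"
  have finV: "finite V" by (simp add: V_def)
  have V: "e * hankel_d m r \<in> V" if "r < 2 ^ K" "e \<in> {- 1, 1}" for e r
    using that unfolding V_def by (intro image_eqI[where x = "(e, r)"]) auto
  have neg: "- x \<in> V" if "x \<in> V" for x
    using that V unfolding V_def by force
  define T where "T = (\<lambda>(x, y) n. block_sign n * (if odd n then x else y)) ` (V \<times> V)"
  have T: "v \<in> T" if "\<And>n. v n = block_sign n * (if odd n then x else y)" "x \<in> V" "y \<in> V"
    for v x y using that unfolding T_def by (intro image_eqI[where x = "(x, y)"]) auto
  have "finite T" using finV by (simp add: T_def)
  moreover have "(\<lambda>n. v (2 * n)) \<in> T" "(\<lambda>n. v (Suc (2 * n))) \<in> T" if "v \<in> T" for v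
  proof -
    from that obtain x y where v: "v = (\<lambda>n. block_sign n * (if odd n then x else y))"
      and xy: "x \<in> V" "y \<in> V" by (auto simp: T_def)
    show "(\<lambda>n. v (2 * n)) \<in> T"
      \<comment> \<open>An even index selects \<open>y\<close>, and appending \<open>0\<close> to an
        odd \<open>n\<close> creates a block \<open>10\<close>, hence the pair
        \<open>(- y, y)\<close>. An odd index selects \<open>x\<close> and creates none.\<close>
      using xy neg by (intro T[of _ "- y" y]) (auto simp: v block_sign_double)
    show "(\<lambda>n. v (Suc (2 * n))) \<in> T"
      using xy by (intro T[of _ x x]) (auto simp: v block_sign_Suc_double)
  qed
  moreover have "(\<lambda>n. hankel_d m (2 ^ K * n + r)) \<in> T" if r: "r < 2 ^ K" for r
    using V[OF r, of 1] V[OF r, of "- 1"]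
    by (intro T[of _ "(if 2 * r + m < 2 ^ K + 1 then - 1 else 1) * hankel_d m r" "1 * hankel_d m r"])
      (auto simp: digits[OF r] simp del: mult_minus1)
  ultimately have "finite (kernel2 (hankel_d m))"
    by (intro finite_kernel2I)
  moreover have "hankel_d m n \<in> V" for n
  proof -
    have "hankel_d m n = hankel_d m (2 ^ K * (n div 2 ^ K) + n mod 2 ^ K)" by simp
    also have "\<dots> \<in> V"
      using block_sign_values[of "n div 2 ^ K"] by (subst digits, simp) (intro V, auto)
    finally show ?thesis .
  qed
  then have "finite (range (hankel_d m))"
    by (meson finV finite_subset image_subsetI)
  ultimately show ?thesis by (simp add: automatic2_def)
qed

subsection \<open>The unshifted sequence\<close>

text \<open>\<open>run_count n\<close> is the number of maximal blocks of equal digits in the binary expansion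
  of \<open>n\<close>.\<close>

fun run_count :: "nat \<Rightarrow> int" where
  "run_count n = (if n = 0 then 0 else
     run_count (n div 2) + (if odd n \<longleftrightarrow> odd (n div 2) then 0 else 1))"

declare run_count.simps [simp del]

lemma run_count_0 [simp]: "run_count 0 = 0"
  by (simp add: run_count.simps)

lemma run_count_double: "run_count (2 * n) = run_count n + (if odd n then 1 else 0)"
  by (cases "n = 0") (auto simp: run_count.simps[of "2 * n"])

lemma run_count_Suc_double: "run_count (Suc (2 * n)) = run_count n + (if odd n then 0 else 1)"
  by (simp add: run_count.simps[of "Suc (2 * n)"])

text \<open>\<open>n\<close> and \<open>n'\<close> are complementary strings of \<open>k + 1\<close>
  digits with the same block boundaries; the leading block of \<open>n'\<close> consists of zeros
  and is not counted.\<close>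

lemma run_count_complement:
  "n + n' + 1 = 2 ^ Suc k \<Longrightarrow> n' \<le> n \<Longrightarrow> run_count n = run_count n' + 1"
proof (induction k arbitrary: n n')
  case 0
  then have "n = 1" "n' = 0" by auto
  then show ?case using run_count_Suc_double[of 0] by simp
next
  case (Suc k)
  define p p' where "p = n div 2" and "p' = n' div 2"
  have eq: "n + n' + 1 = 2 * 2 ^ Suc k" using Suc.prems by simp
  then have par: "odd n \<longleftrightarrow> even n'" by (metis even_Suc even_add even_mult_iff Suc_eq_plus1 even_numeral)
  have sum: "p + p' + 1 = 2 ^ Suc k"
    using eq par unfolding p_def p'_def by linarith
  then have par': "odd p \<longleftrightarrow> even p'" by (metis even_Suc even_add even_mult_iff Suc_eq_plus1 even_numeral power_Suc)
  have IH: "run_count p = run_count p' + 1"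
    using Suc.prems by (intro Suc.IH[OF sum]) (simp add: p_def p'_def div_le_mono)
  show ?case
  proof (cases "even n")
    case True
    then have "n = 2 * p" "n' = Suc (2 * p')" using par by (auto simp: p_def p'_def)
    then show ?thesis using IH par' by (simp add: run_count_double run_count_Suc_double)
  next
    case False
    then have "n = Suc (2 * p)" "n' = 2 * p'" using par by (auto simp: p_def p'_def)
    then show ?thesis using IH par' by (simp add: run_count_double run_count_Suc_double)
  qed
qed

text \<open>Appending a fixed digit string adds a constant number of blocks, up to the seam, which
  depends only on the last digit of \<open>n\<close>.\<close>

lemma run_count_kernel:
  "j < 2 ^ i \<Longrightarrow> \<exists>x y. \<forall>n. run_count (2 ^ i * n + j) = run_count n + x + (if odd n then y else 0)"
proof (induction i arbitrary: j)
  case 0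
  then show ?case by (intro exI[of _ 0]) auto
next
  case (Suc i)
  show ?case
  proof (cases "j < 2 ^ i")
    case True
    then obtain x y where xy: "\<And>n. run_count (2 ^ i * n + j) = run_count n + x + (if odd n then y else 0)"
      using Suc.IH by blast
    have "run_count (2 ^ Suc i * n + j) = run_count n + x + (if odd n then 1 else 0)" for n
    proof -
      have "2 ^ Suc i * n + j = 2 ^ i * (2 * n) + j" by simp
      then show ?thesis using xy[of "2 * n"] by (simp only: run_count_double) simp
    qed
    then show ?thesis by blast
  next
    case False
    define l where "l = j - 2 ^ i"
    have l: "j = l + 2 ^ i" "l < 2 ^ i" using False Suc.prems by (auto simp: l_def)
    then obtain x y where xy: "\<And>n. run_count (2 ^ i * n + l) = run_count n + x + (if odd n then y else 0)"
      using Suc.IH by blast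
    have "run_count (2 ^ Suc i * n + j) = run_count n + (x + y + 1) + (if odd n then - 1 else 0)" for n
    proof -
      have "2 ^ Suc i * n + j = 2 ^ i * Suc (2 * n) + l" by (simp add: l(1))
      then show ?thesis using xy[of "Suc (2 * n)"] by (simp only: run_count_Suc_double) simp
    qed
    then show ?thesis by blast
  qed
qed

text \<open>The reflections of \<open>hankel_d 0 (Suc n)\<close> and \<open>hankel_d 2 n\<close>
  share the partner \<open>n'\<close> and the sign; the correction term then matches the block
  gained in \<open>run_count_complement\<close>.\<close>

lemma hankel_d_0_Suc: "hankel_d 0 (Suc n) = - (hankel_d 2 n * run_count n)"
proof (induction n rule: less_induct)
  case (less n)
  show ?case
  proof (cases "n = 0")
    case True
    have "det (mat 1 1 (\<lambda>(i, j). pow2_ind (i + j + 0))) = 0"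
      by (subst det_single) (auto simp: pow2_ind_def)
    then show ?thesis using True by (simp add: hankel_d_def)
  next
    case False
    then obtain k where k: "2 ^ k \<le> n" "n < 2 ^ Suc k"
      using ex_power_ivl1[of 2 n] by auto
    define n' where "n' = 2 ^ Suc k - 1 - n"
    have n': "n' + n + 1 = 2 ^ Suc k" "n' \<le> n" "n' < n" using k by (auto simp: n'_def)
    have "hankel_d 0 (Suc n) = (- 1) ^ ((n - n') div 2) * (hankel_d 0 (Suc n') - hankel_d 2 n')"
      by (rule hankel_reflect_0[OF n'(2,1)])
    also have "\<dots> = - ((- 1) ^ ((n - n') div 2) * hankel_d 2 n' * (run_count n' + 1))"
      by (simp add: less.IH[OF n'(3)] algebra_simps)
    also have "(- 1) ^ ((n - n') div 2) * hankel_d 2 n' = hankel_d 2 n"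
      using n' by (intro hankel_reflect[symmetric, where k = k]) auto
    also have "run_count n' + 1 = run_count n"
      using n' by (intro run_count_complement[symmetric, where k = k]) auto
    finally show ?thesis .
  qed
qed

section \<open>Integer combinations and 2-regularity\<close>

definition int_comb :: "(nat \<Rightarrow> int) set \<Rightarrow> (nat \<Rightarrow> int) \<Rightarrow> bool" where
  "int_comb S v \<longleftrightarrow> (\<exists>c. \<forall>n. v n = (\<Sum>s\<in>S. c s * s n))"

lemma regular2_iff: "regular2 u \<longleftrightarrow> (\<exists>S. finite S \<and> (\<forall>v\<in>kernel2 u. int_comb S v))"
  by (auto simp: regular2_def int_comb_def)

lemma int_comb_zero: "int_comb S (\<lambda>n. 0)"
  unfolding int_comb_def by (intro exI[of _ "\<lambda>_. 0"]) simp

lemma int_comb_base: "finite S \<Longrightarrow> s \<in> S \<Longrightarrow> int_comb S s"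
  unfolding int_comb_def
  by (intro exI[of _ "\<lambda>t. if t = s then 1 else 0"]) (simp add: if_distrib[of "\<lambda>x. x * _"] cong: if_cong)

lemma int_comb_add: "int_comb S v \<Longrightarrow> int_comb S w \<Longrightarrow> int_comb S (\<lambda>n. v n + w n)"
proof -
  assume "int_comb S v" "int_comb S w"
  then obtain c d where "\<And>n. v n = (\<Sum>s\<in>S. c s * s n)" "\<And>n. w n = (\<Sum>s\<in>S. d s * s n)"
    unfolding int_comb_def by blast
  then show ?thesis unfolding int_comb_def
    by (intro exI[of _ "\<lambda>s. c s + d s"]) (simp add: algebra_simps sum.distrib)
qed

lemma int_comb_mult: "int_comb S v \<Longrightarrow> int_comb S (\<lambda>n. c * v n)"
proof -
  assume "int_comb S v"
  then obtain d where "\<And>n. v n = (\<Sum>s\<in>S. d s * s n)"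
    unfolding int_comb_def by blast
  then show ?thesis unfolding int_comb_def
    by (intro exI[of _ "\<lambda>s. c * d s"]) (simp add: mult.assoc sum_distrib_left)
qed

lemma int_comb_sum:
  "finite I \<Longrightarrow> (\<And>i. i \<in> I \<Longrightarrow> int_comb S (f i)) \<Longrightarrow> int_comb S (\<lambda>n. \<Sum>i\<in>I. f i n)"
  by (induction I rule: finite_induct) (auto intro: int_comb_zero int_comb_add)

lemma kernel2I: "j < 2 ^ i \<Longrightarrow> (\<lambda>n. u (2 ^ i * n + j)) \<in> kernel2 u"
  by (auto simp: kernel2_def)

text \<open>A kernel element of \<open>u\<close> with offset \<open>j > 0\<close> is one of the
  shifted sequence with offset \<open>j - 1\<close>. For \<open>j = 0\<close> it is the one with
  offset \<open>2 ^ i - 1\<close>, delayed by one place and started with \<open>u 0\<close>;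
  \<open>sh\<close> and \<open>\<delta>\<close> supply the delay and the start.\<close>

lemma regular2_Suc_cancel:
  fixes u :: "nat \<Rightarrow> int"
  assumes "regular2 (\<lambda>n. u (Suc n))"
  shows "regular2 u"
proof -
  obtain S where S: "finite S" and comb: "\<And>v. v \<in> kernel2 (\<lambda>n. u (Suc n)) \<Longrightarrow> int_comb S v"
    using assms by (auto simp: regular2_iff)
  define \<delta> :: "nat \<Rightarrow> int" where "\<delta> n = (if n = 0 then 1 else 0)" for n
  define sh :: "(nat \<Rightarrow> int) \<Rightarrow> nat \<Rightarrow> int" where "sh s n = (if n = 0 then 0 else s (n - 1))" for s n
  define S' where "S' = insert \<delta> (S \<union> sh ` S)"
  have S': "finite S'" "\<delta> \<in> S'" "\<And>s. s \<in> S \<Longrightarrow> s \<in> S'" "\<And>s. s \<in> S \<Longrightarrow> sh s \<in> S'"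
    using S by (auto simp: S'_def)
  have "int_comb S' v" if "v \<in> kernel2 u" for v
  proof -
    obtain i j where v: "v = (\<lambda>n. u (2 ^ i * n + j))" and j: "j < 2 ^ i"
      using \<open>v \<in> kernel2 u\<close> by (auto simp: kernel2_def)
    have lift: "\<exists>c. \<forall>n. u (Suc (2 ^ i * n + l)) = (\<Sum>s\<in>S. c s * s n)" if "l < 2 ^ i" for l
      using comb[OF kernel2I[OF that]] by (simp add: int_comb_def)
    show ?thesis
    proof (cases j)
      case (Suc l)
      with j obtain c where "\<And>n. u (Suc (2 ^ i * n + l)) = (\<Sum>s\<in>S. c s * s n)"
        using lift[of l] by auto
      then have "v = (\<lambda>n. \<Sum>s\<in>S. c s * s n)" by (simp add: v Suc)
      then show ?thesis
        using S S' by (simp only:) (intro int_comb_sum int_comb_mult int_comb_base, auto)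
    next
      case 0
      obtain c where c: "\<And>n. u (Suc (2 ^ i * n + (2 ^ i - 1))) = (\<Sum>s\<in>S. c s * s n)"
        using lift[of "2 ^ i - 1"] by auto
      have "v n = u 0 * \<delta> n + (\<Sum>s\<in>S. c s * sh s n)" for n
      proof (cases n)
        case (Suc k)
        have "Suc (2 ^ i * k + (2 ^ i - 1)) = 2 ^ i * n + j" by (simp add: Suc 0)
        then have "v n = (\<Sum>s\<in>S. c s * s k)" using c[of k] by (simp only: v)
        then show ?thesis by (simp add: \<delta>_def sh_def Suc)
      qed (simp add: v 0 \<delta>_def sh_def)
      then have "v = (\<lambda>n. u 0 * \<delta> n + (\<Sum>s\<in>S. c s * sh s n))" by auto
      then show ?thesis
        using S S' by (simp only:) (intro int_comb_add int_comb_sum int_comb_mult int_comb_base, auto)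
    qed
  qed
  with S' show ?thesis by (auto simp: regular2_iff)
qed

text \<open>By \<open>run_count_kernel\<close>, each of the finitely many kernel elements
  \<open>w\<close> of \<open>c\<close> needs just three generators: \<open>w\<close> times
  \<open>run_count\<close>, \<open>w\<close>, and \<open>w\<close> restricted to odd
  \<open>n\<close>.\<close>

lemma regular2_mult_run_count:
  fixes c :: "nat \<Rightarrow> int"
  assumes "finite (kernel2 c)"
  shows "regular2 (\<lambda>n. - (c n * run_count n))"
proof -
  define S where "S = (\<Union>w\<in>kernel2 c. {\<lambda>n. w n * run_count n, w, \<lambda>n. w n * (if odd n then 1 else 0)})"
  have S: "finite S" using assms by (simp add: S_def)
  have "int_comb S v" if "v \<in> kernel2 (\<lambda>n. - (c n * run_count n))" for v
  proof -
    obtain i j where v: "v = (\<lambda>n. - (c (2 ^ i * n + j) * run_count (2 ^ i * n + j)))" and j: "j < 2 ^ i"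
      using \<open>v \<in> _\<close> by (auto simp: kernel2_def)
    define w where "w n = c (2 ^ i * n + j)" for n
    have "w \<in> kernel2 c" using kernel2I[OF j, of c] by (simp add: w_def[abs_def])
    then have mem: "(\<lambda>n. w n * run_count n) \<in> S" "w \<in> S" "(\<lambda>n. w n * (if odd n then 1 else 0)) \<in> S"
      by (auto simp: S_def)
    obtain x y where "\<And>n. run_count (2 ^ i * n + j) = run_count n + x + (if odd n then y else 0)"
      using run_count_kernel[OF j] by blast
    then have veq: "v = (\<lambda>n. - 1 * (w n * run_count n) + (- x * w n + - y * (w n * (if odd n then 1 else 0))))"
      by (auto simp: v w_def algebra_simps)
    show ?thesis
      unfolding veq using S mem by (intro int_comb_add int_comb_mult int_comb_base)
  qed
  with S show ?thesis by (auto simp: regular2_iff)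
qed

theorem theorem3:
  shows "regular2 (\<lambda>n. hankel_d 0 n)
    \<and> (\<forall>k\<ge>1. automatic2 (\<lambda>n. hankel_d (2 * k) n))
    \<and> (\<forall>k. periodic_seq (\<lambda>n. hankel_d (2 * k + 1) n))"
proof (intro conjI allI impI)
  have "finite (kernel2 (hankel_d 2))"
    using automatic_hankel_even[of 2] by (simp add: automatic2_def)
  then have "regular2 (\<lambda>n. hankel_d 0 (Suc n))"
    by (simp add: hankel_d_0_Suc regular2_mult_run_count)
  then show "regular2 (\<lambda>n. hankel_d 0 n)"
    by (rule regular2_Suc_cancel)
next
  fix k :: nat
  assume "1 \<le> k"
  then show "automatic2 (\<lambda>n. hankel_d (2 * k) n)"
    by (intro automatic_hankel_even) auto
next
  fix k :: nat
  show "periodic_seq (\<lambda>n. hankel_d (2 * k + 1) n)"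
    by (intro periodic_hankel_odd) auto
qed

end
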